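(* For any $n\in\mathbb{N}$, the class of $2n$-balanced rotor types is closed under $UU$, $UD$, $DU$, and $DD$.
   Context: A rotor type is an infinite periodic sequence $r=(r^{(1)},r^{(2)},\dots)$ of states with fundamental period $|r|$. A two-state rotor type is written over $\{1,2\}$ (convention $r^{(1)}=1$). For $N\in\mathbb{N}$, a two-state rotor type $r$ is $N$-balanced if $N$ divides its fundamental period and, for every $k\ge 0$, the block $r^{(kN+1)},\dots,r^{(kN+N)}$ contains equally many $1$'s and $2$'s. Rotor-router dynamics: at each non-target vertex $v$ there is a periodic sequence $e_v^{(1)},e_v^{(2)},\dots$ of out-edges; a particle starts at the source, on its $n$-th visit to a non-target vertex $v$ leaves along $e_v^{(n)}$, and whenever it reaches a target it is returned to the source; the hitting sequence is the (periodic) sequence of targets reached. The compressor for $r$ has non-target vertices $1$ (source), $2,3$ and targets $4,5$. On the $j$-th departure: from vertex $1$ the particle goes to vertex $2$ if $r^{(j)}=1$ and to vertex $3$ if $r^{(j)}=2$; from vertex $2$, in variant $U$ it goes to vertex $1$ if $r^{(j)}=1$ and to target $4$ if $r^{(j)}=2$, in variant $D$ to target $4$ if $r^{(j)}=1$ and to vertex $1$ if $r^{(j)}=2$; from vertex $3$ likewise with target $5$. For $X,Y\in\{U,D\}$, $XY(r)$ is the hitting sequence with variant $X$ at vertex $2$ and $Y$ at vertex $3$, viewed as a rotor type with $4$ written as $1$ and $5$ as $2$.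
   Formalization: N-balanced is taken to require that N divides some period, not necessarily the fundamental period; with the fundamental period the claim fails: 11221212 is 4-balanced, but its image under UU is 1212..., of fundamental period 2. *)

theory Defs
  imports Main "HOL-Library.Infinite_Set"
begin

text \<open>
  Sequences are indexed from \<open>0\<close>: \<open>r i\<close> is the entry \<open>r\<^sup>(\<^sup>i\<^sup>+\<^sup>1\<^sup>)\<close> of the one-based notation.
\<close>

definition is_period :: "(nat \<Rightarrow> 'a) \<Rightarrow> nat \<Rightarrow> bool" where
  "is_period r p \<longleftrightarrow> p > 0 \<and> (\<forall>i. r (i + p) = r i)"

definition rotor_type :: "(nat \<Rightarrow> 'a) \<Rightarrow> bool" where
  "rotor_type r \<longleftrightarrow> (\<exists>p. is_period r p)"

text \<open>
  The convention that a two-state rotor type starts with \<open>1\<close> is kept separate, in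
  \<open>balanced_rotor_types\<close>, because a hitting sequence, read literally, may start with \<open>2\<close>.
\<close>

definition two_state :: "(nat \<Rightarrow> nat) \<Rightarrow> bool" where
  "two_state r \<longleftrightarrow> rotor_type r \<and> range r = {1, 2}"

text \<open>
  A sequence is \<open>N\<close>-balanced with respect to a period \<open>p\<close>. The period need not be the least one.
  If \<open>p\<close> is required to be the fundamental period of each sequence, the \<open>2 * n\<close>-balanced rotor
  types are not closed under the compressors: the sequence with fundamental period \<open>11221212\<close> is
  \<open>4\<close>-balanced, but its image under \<open>UU\<close> is \<open>121212...\<close>, whose fundamental period is \<open>2\<close>.
\<close>

definition balanced_wrt :: "nat \<Rightarrow> nat \<Rightarrow> (nat \<Rightarrow> nat) \<Rightarrow> bool" where
  "balanced_wrt N p r \<longleftrightarrow> two_state r \<and> is_period r p \<and> N dvd p \<and>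
     (\<forall>k. card {i \<in> {k * N ..< k * N + N}. r i = 1} = card {i \<in> {k * N ..< k * N + N}. r i = 2})"

definition balanced_rotor_types :: "nat \<Rightarrow> (nat \<Rightarrow> nat) set" where
  "balanced_rotor_types N = {r. (\<exists>p. balanced_wrt N p r) \<and> r 0 = 1}"

text \<open>Renaming of the two states, if necessary, so that the convention \<open>r\<^sup>(\<^sup>1\<^sup>) = 1\<close> holds.\<close>

definition normalize_states :: "(nat \<Rightarrow> nat) \<Rightarrow> nat \<Rightarrow> nat" where
  "normalize_states r = (if r 0 = 1 then r else (\<lambda>i. if r i = 1 then 2 else 1))"

text \<open>
  Rotor-router walk with source \<open>s\<close>, target set \<open>T\<close> and rotors \<open>e\<close>, where \<open>e v j\<close> is the head of
  the edge used on departure number \<open>j\<close> (counted from \<open>0\<close>) from the non-target vertex \<open>v\<close>. A state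
  consists of the position of the particle and of the number of past departures from each vertex.
\<close>

fun rotor_step :: "'v \<Rightarrow> 'v set \<Rightarrow> ('v \<Rightarrow> nat \<Rightarrow> 'v) \<Rightarrow> 'v \<times> ('v \<Rightarrow> nat) \<Rightarrow> 'v \<times> ('v \<Rightarrow> nat)" where
  "rotor_step s T e (v, c) = (if v \<in> T then (s, c) else (e v (c v), c(v := Suc (c v))))"

definition rotor_walk :: "'v \<Rightarrow> 'v set \<Rightarrow> ('v \<Rightarrow> nat \<Rightarrow> 'v) \<Rightarrow> nat \<Rightarrow> 'v" where
  "rotor_walk s T e t = fst ((rotor_step s T e ^^ t) (s, \<lambda>_. 0))"

definition hitting_times :: "'v \<Rightarrow> 'v set \<Rightarrow> ('v \<Rightarrow> nat \<Rightarrow> 'v) \<Rightarrow> nat set" where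
  "hitting_times s T e = {t. rotor_walk s T e t \<in> T}"

text \<open>Meaningful only if \<open>hitting_times s T e\<close> is infinite.\<close>

definition hitting_sequence :: "'v \<Rightarrow> 'v set \<Rightarrow> ('v \<Rightarrow> nat \<Rightarrow> 'v) \<Rightarrow> nat \<Rightarrow> 'v" where
  "hitting_sequence s T e k = rotor_walk s T e (enumerate (hitting_times s T e) k)"

datatype variant = U | D

fun branch :: "variant \<Rightarrow> nat \<Rightarrow> nat \<Rightarrow> nat" where
  "branch U t x = (if x = 1 then 1 else t)"
| "branch D t x = (if x = 1 then t else 1)"

text \<open>The values at the targets \<open>4\<close> and \<open>5\<close> (and at non-vertices) are irrelevant.\<close>

definition compressor_rotor :: "variant \<Rightarrow> variant \<Rightarrow> (nat \<Rightarrow> nat) \<Rightarrow> nat \<Rightarrow> nat \<Rightarrow> nat" where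
  "compressor_rotor X Y r v j =
     (if v = 1 then (if r j = 1 then 2 else 3)
      else if v = 2 then branch X 4 (r j)
      else if v = 3 then branch Y 5 (r j)
      else 1)"

definition compressor :: "variant \<Rightarrow> variant \<Rightarrow> (nat \<Rightarrow> nat) \<Rightarrow> nat \<Rightarrow> nat" where
  "compressor X Y r k =
     (if hitting_sequence 1 {4, 5} (compressor_rotor X Y r) k = 4 then 1 else 2)"

end

theory Submission
  imports Defs
begin

text \<open>
  Say that a set of times is balanced if it contains \<open>n\<close> of the \<open>2 * n\<close> elements of each aligned block.
  The first \<open>2 * (k * 2 * n)\<close> departures from the source send the particle \<open>k * 2 * n\<close> times to each of
  the vertices 2 and 3, that is, through exactly \<open>k\<close> blocks of their rotors, so each target has been hit
  exactly \<open>k * n\<close> times by then. Hence block \<open>k\<close> of the hitting sequence is produced by the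
  input blocks \<open>2 * k\<close> and \<open>2 * k + 1\<close>, and a period of \<open>p\<close> outputs by \<open>2 * p\<close> departures from the source.
\<close>

section \<open>Counting and enumerating sets of natural numbers\<close>

definition cnt :: "nat set \<Rightarrow> nat \<Rightarrow> nat" where
  "cnt S m = card {i \<in> S. i < m}"

lemma cnt_0 [simp]: "cnt S 0 = 0"
  by (simp add: cnt_def)

lemma cnt_Suc [simp]: "cnt S (Suc m) = cnt S m + (if m \<in> S then 1 else 0)"
proof -
  have "{i \<in> S. i < Suc m} = (if m \<in> S then insert m {i \<in> S. i < m} else {i \<in> S. i < m})"
    by (auto simp: less_Suc_eq)
  then show ?thesis
    by (simp add: cnt_def)
qed

lemma cnt_diff: "l \<le> m \<Longrightarrow> cnt S m = cnt S l + card {i \<in> {l..<m}. i \<in> S}"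
proof (induction m rule: dec_induct)
  case (step m)
  have "{i \<in> {l..<Suc m}. i \<in> S} =
      (if m \<in> S then insert m {i \<in> {l..<m}. i \<in> S} else {i \<in> {l..<m}. i \<in> S})"
    using step by (auto simp: less_Suc_eq)
  with step show ?case
    by simp
qed simp

lemma cnt_Compl: "cnt S m + cnt (- S) m = m"
  by (induction m) auto

lemma cnt_Un: "S \<inter> S' = {} \<Longrightarrow> cnt (S \<union> S') m = cnt S m + cnt S' m"
  by (induction m) auto

lemma cnt_shift:
  assumes "\<And>i. i + p \<in> S \<longleftrightarrow> i \<in> S"
  shows "cnt S (m + p) = cnt S m + cnt S p"
  by (induction m) (use assms in auto)

lemma infinite_if_cnt_unbounded:
  assumes "\<And>m. \<exists>l. m < cnt S l"
  shows "infinite S"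
proof
  assume "finite S"
  then have "cnt S l \<le> card S" for l
    unfolding cnt_def by (intro card_mono) auto
  with assms[of "card S"] show False
    using not_less by blast
qed

lemma cnt_enumerate:
  assumes "infinite S"
  shows "cnt S (enumerate S k) = k"
proof -
  have "{i \<in> S. i < enumerate S k} = enumerate S ` {..<k}"
  proof (intro subset_antisym subsetI)
    fix i
    assume i: "i \<in> {i \<in> S. i < enumerate S k}"
    then obtain l where "i = enumerate S l"
      using enumerate_Ex[OF assms] by blast
    with i assms show "i \<in> enumerate S ` {..<k}"
      by simp
  qed (use assms in \<open>auto simp: enumerate_in_set\<close>)
  then show ?thesis
    unfolding cnt_def
    using assms by (simp add: card_image inj_on_subset[OF inj_enumerate])
qed

lemma enumerate_cnt:
  assumes "infinite S" "j \<in> S"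
  shows "enumerate S (cnt S j) = j"
  using assms by (metis cnt_enumerate enumerate_Ex)

text \<open>A strictly increasing map preserves the number of smaller elements, and that number is
  the index in the enumeration.\<close>

lemma enumerate_image_strict_mono:
  fixes f :: "nat \<Rightarrow> nat"
  assumes "infinite S" "strict_mono f"
  shows "enumerate (f ` S) k = f (enumerate S k)"
proof -
  let ?j = "enumerate S k"
  have inj: "inj_on f A" for A
    using assms(2) by (meson inj_on_subset strict_mono_imp_inj_on top_greatest)
  have "{i \<in> f ` S. i < f ?j} = f ` {i \<in> S. i < ?j}"
    using assms(2) by (auto simp: strict_mono_less)
  then have "cnt (f ` S) (f ?j) = cnt S ?j"
    by (simp add: cnt_def card_image[OF inj])
  moreover have "infinite (f ` S)"
    using assms(1) finite_image_iff[OF inj] by blast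
  ultimately show ?thesis
    using enumerate_cnt[of "f ` S" "f ?j"] assms(1) by (simp add: cnt_enumerate enumerate_in_set)
qed

lemma enumerate_shift:
  assumes "infinite S" "\<And>i. i + p \<in> S \<longleftrightarrow> i \<in> S"
  shows "enumerate S (k + cnt S p) = enumerate S k + p"
proof -
  have "cnt S (enumerate S k + p) = k + cnt S p"
    using cnt_shift[OF assms(2)] assms(1) by (simp add: cnt_enumerate)
  then show ?thesis
    using enumerate_cnt[of S "enumerate S k + p"] assms by (simp add: enumerate_in_set)
qed

text \<open>As \<open>m\<close> passes an element of \<open>S\<close>, \<open>cnt S m\<close> passes
  the index of that element. This turns counts of output positions into counts of source
  departures.\<close>

lemma cnt_vimage_enumerate:
  assumes "infinite S"
  shows "cnt {k. enumerate S k \<in> C} (cnt S m) = cnt (S \<inter> C) m"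
  by (induction m) (use assms in \<open>auto simp: enumerate_cnt\<close>)

text \<open>If \<open>S\<close> holds the source departures to a vertex and \<open>C\<close> the
  departures from there to its target, these are the source departures that end in that
  target.\<close>

definition thin :: "nat set \<Rightarrow> nat set \<Rightarrow> nat set" where
  "thin S C = {j \<in> S. cnt S j \<in> C}"

text \<open>The elements of \<open>S\<close> below \<open>m\<close> have the ranks \<open>0\<close>,
  ..., \<open>cnt S m - 1\<close>.\<close>

lemma cnt_thin: "cnt (thin S C) m = cnt C (cnt S m)"
  by (induction m) (auto simp: thin_def)

lemma thin_shift:
  assumes "\<And>i. i + q \<in> S \<longleftrightarrow> i \<in> S" "\<And>i. i + cnt S q \<in> C \<longleftrightarrow> i \<in> C"
  shows "j + q \<in> thin S C \<longleftrightarrow> j \<in> thin S C"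
  using assms by (simp add: thin_def cnt_shift)

section \<open>Balanced sets and balanced sequences\<close>

text \<open>Cumulative counts, unlike counts per block, compose directly under
  \<open>cnt_thin\<close>.\<close>

definition balanced_set :: "nat \<Rightarrow> nat set \<Rightarrow> bool" where
  "balanced_set n S \<longleftrightarrow> (\<forall>k. cnt S (k * (2 * n)) = k * n)"

lemma balanced_set_Compl: "balanced_set n S \<Longrightarrow> balanced_set n (- S)"
  unfolding balanced_set_def
proof
  fix k
  assume "\<forall>k. cnt S (k * (2 * n)) = k * n"
  then show "cnt (- S) (k * (2 * n)) = k * n"
    using cnt_Compl[of S "k * (2 * n)"] by (simp add: algebra_simps)
qed

text \<open>A block has \<open>2 * n\<close> elements, so equal halves have \<open>n\<close> each;
  sums and differences over blocks translate between the two forms.\<close>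

lemma balanced_set_iff_blocks:
  "balanced_set n S \<longleftrightarrow>
    (\<forall>k. card {i \<in> {k * (2 * n)..<k * (2 * n) + 2 * n}. i \<in> S} =
         card {i \<in> {k * (2 * n)..<k * (2 * n) + 2 * n}. i \<notin> S})"
    (is "_ \<longleftrightarrow> (\<forall>k. ?in k = ?out k)")
proof -
  have 1: "?in k + ?out k = 2 * n" for k
  proof -
    have "card {i \<in> {l..<l + m}. i \<in> S} + card {i \<in> {l..<l + m}. i \<notin> S} = m" for l m :: nat
      using cnt_diff[of l "l + m" S] cnt_diff[of l "l + m" "- S"]
        cnt_Compl[of S l] cnt_Compl[of S "l + m"] by simp
    then show ?thesis .
  qed
  have 2: "cnt S (Suc k * (2 * n)) = cnt S (k * (2 * n)) + ?in k" for k
    using cnt_diff[of "k * (2 * n)" "k * (2 * n) + 2 * n" S] by (simp add: add.commute)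
  show ?thesis
  proof
    assume bal: "balanced_set n S"
    have "?in k = n" for k
    proof -
      have "cnt S (Suc k * (2 * n)) = Suc k * n" "cnt S (k * (2 * n)) = k * n"
        using bal unfolding balanced_set_def by blast+
      with 2[of k] show ?thesis by simp
    qed
    moreover have "?out k = n" if "?in k = n" for k
      using 1[of k] that by linarith
    ultimately show "\<forall>k. ?in k = ?out k" by simp
  next
    assume eq: "\<forall>k. ?in k = ?out k"
    have n: "?in k = n" for k
      using 1[of k] eq[rule_format, of k] by linarith
    have "cnt S (k * (2 * n)) = k * n" for k
    proof (induction k)
      case (Suc k)
      with 2[of k] n[of k] show ?case by simp
    qed simp
    then show "balanced_set n S"
      by (simp add: balanced_set_def)
  qed
qed

lemma balanced_wrtD:
  assumes "balanced_wrt (2 * n) p r"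
  shows "range r = {1, 2}" "is_period r p" "2 * n dvd p" "balanced_set n {i. r i = 1}"
proof -
  show "range r = {1, 2}" "is_period r p" "2 * n dvd p"
    using assms by (auto simp: balanced_wrt_def two_state_def)
  then have "r i = 2 \<longleftrightarrow> \<not> r i = 1" for i
    by (metis insertE numeral_One one_eq_numeral_iff rangeI semiring_norm(85) singletonD)
  with assms show "balanced_set n {i. r i = 1}"
    by (simp add: balanced_wrt_def balanced_set_iff_blocks)
qed

text \<open>An inclusion for the range suffices: a positive period divisible by \<open>2 * n\<close>
  gives \<open>n > 0\<close>, so the first block contains both states.\<close>

lemma balanced_wrtI:
  assumes "range r \<subseteq> {1, 2}" "is_period r p" "2 * n dvd p" "balanced_set n {i. r i = 1}"
  shows "balanced_wrt (2 * n) p r"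
proof -
  have 2: "r i = 2 \<longleftrightarrow> \<not> r i = 1" for i
    using assms(1) by (metis insertE numeral_One one_eq_numeral_iff rangeI semiring_norm(85) singletonD subsetD)
  have n: "n > 0"
    using assms(2,3) by (auto simp: is_period_def intro: Nat.gr0I)
  have ex: "\<exists>i. i \<in> S" if "balanced_set n S" for S
  proof (rule ccontr)
    assume "\<nexists>i. i \<in> S"
    then have "cnt S m = 0" for m
      by (simp add: cnt_def)
    with that n show False
      unfolding balanced_set_def by (metis mult_1 less_irrefl)
  qed
  obtain i j where "r i = 1" "r j = 2"
    using ex[OF assms(4)] ex[OF balanced_set_Compl[OF assms(4)]] 2 by auto
  then have "{1, 2} \<subseteq> range r"
    by (metis empty_subsetI insert_subset rangeI)
  with assms(1) have "range r = {1, 2}"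
    by (rule subset_antisym)
  moreover have "rotor_type r"
    using assms(2) by (auto simp: rotor_type_def)
  moreover have "\<forall>k. card {i \<in> {k * (2 * n) ..< k * (2 * n) + 2 * n}. r i = 1} =
      card {i \<in> {k * (2 * n) ..< k * (2 * n) + 2 * n}. r i = 2}"
    using assms(4) by (simp add: balanced_set_iff_blocks 2)
  ultimately show ?thesis
    using assms(2,3) by (simp add: balanced_wrt_def two_state_def)
qed

lemma balanced_wrt_normalize_states:
  assumes "balanced_wrt (2 * n) p r"
  shows "balanced_wrt (2 * n) p (normalize_states r)"
proof (cases "r 0 = 1")
  case False
  let ?r = "normalize_states r"
  have r: "?r = (\<lambda>i. if r i = 1 then 2 else 1)"
    using False by (simp add: normalize_states_def)
  show ?thesis
  proof (rule balanced_wrtI)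
    have "{i. ?r i = 1} = - {i. r i = 1}"
      by (auto simp: r)
    then show "balanced_set n {i. ?r i = 1}"
      using balanced_wrtD(4)[OF assms] by (simp add: balanced_set_Compl)
  qed (use balanced_wrtD[OF assms] in \<open>auto simp: r is_period_def\<close>)
qed (use assms in \<open>simp add: normalize_states_def\<close>)

lemma normalize_states_0: "normalize_states r 0 = 1"
  by (simp add: normalize_states_def)

section \<open>Source departures that lead to a target\<close>

text \<open>With \<open>S\<close> the positions of state 1, these are the departures from vertex 2
  or 3 that go to the target.\<close>

definition exit_set :: "variant \<Rightarrow> nat set \<Rightarrow> nat set" where
  "exit_set X S = (case X of U \<Rightarrow> - S | D \<Rightarrow> S)"

lemma balanced_set_exit_set: "balanced_set n S \<Longrightarrow> balanced_set n (exit_set X S)"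
  by (cases X) (simp_all add: exit_set_def balanced_set_Compl)

definition hits :: "variant \<Rightarrow> variant \<Rightarrow> nat set \<Rightarrow> nat set" where
  "hits X Y S = thin S (exit_set X S) \<union> thin (- S) (exit_set Y S)"

section \<open>The rotor walk of a compressor\<close>

context
  fixes X Y :: variant and r :: "nat \<Rightarrow> nat" and S :: "nat set"
  assumes S_iff: "i \<in> S \<longleftrightarrow> r i = 1"
begin

declare One_nat_def [simp del]

abbreviation (input) "stp \<equiv> rotor_step 1 {4, 5 :: nat} (compressor_rotor X Y r)"

text \<open>The counters when the particle is at the source after \<open>j\<close> departures from
  it. Targets keep the value 0, since \<open>rotor_step\<close> does not count departures from
  them.\<close>

abbreviation (input) "departures j \<equiv>
  (\<lambda>v::nat. if v = 1 then j else if v = 2 then cnt S j else if v = 3 then cnt (- S) j else 0)"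

text \<open>The time of source departure \<open>j\<close>: each earlier excursion took two steps,
  and a third one back from the target if there was a hit.\<close>

definition start :: "nat \<Rightarrow> nat" where
  "start j = 2 * j + cnt (hits X Y S) j"

lemma start_Suc: "start (Suc j) = start j + (if j \<in> hits X Y S then 3 else 2)"
  by (simp add: start_def)

lemma branch_exit_set: "branch Z t (r i) = (if i \<in> exit_set Z S then t else 1)"
  by (cases Z) (simp_all add: exit_set_def S_iff)

lemma hits_iff:
  "j \<in> hits X Y S \<longleftrightarrow>
    (if j \<in> S then cnt S j \<in> exit_set X S else cnt (- S) j \<in> exit_set Y S)"
  by (auto simp: hits_def thin_def)

lemma step1: "stp (1, departures j) = (if j \<in> S then 2 else 3, (departures j)(1 := Suc j))"
  by (auto simp: compressor_rotor_def S_iff)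

lemma step2: "stp (stp (1, departures j)) =
    (if j \<in> hits X Y S then if j \<in> S then 4 else 5 else 1, departures (Suc j))"
  unfolding step1 hits_iff
  by (auto simp: compressor_rotor_def fun_eq_iff branch_exit_set)

lemma walk_start: "(stp ^^ start j) (1, \<lambda>_. 0) = (1, departures j)"
proof (induction j)
  case 0
  then show ?case by (simp add: start_def fun_eq_iff)
next
  case (Suc j)
  have "(stp ^^ start (Suc j)) (1, \<lambda>_. 0) =
      (stp ^^ (if j \<in> hits X Y S then 3 else 2)) (1, departures j)"
    unfolding start_Suc by (subst add.commute) (simp only: funpow_add o_apply Suc)
  also have "\<dots> = (if j \<in> hits X Y S then stp (stp (stp (1, departures j)))
      else stp (stp (1, departures j)))"
    by (simp add: numeral_3_eq_3 numeral_2_eq_2)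
  also have "\<dots> = (1, departures (Suc j))"
    unfolding step2 by simp
  finally show ?case .
qed

lemma rotor_walk_start:
  "rotor_walk 1 {4, 5} (compressor_rotor X Y r) (start j + d) =
    fst ((stp ^^ d) (1, departures j))"
  unfolding rotor_walk_def
  by (subst add.commute) (simp only: funpow_add o_apply walk_start)

lemma rotor_walk_start_2:
  "rotor_walk 1 {4, 5} (compressor_rotor X Y r) (start j + 2) =
    (if j \<in> hits X Y S then if j \<in> S then 4 else 5 else 1)"
proof -
  have "(stp ^^ 2) x = stp (stp x)" for x
    by (simp add: numeral_2_eq_2 del: rotor_step.simps)
  then show ?thesis
    unfolding rotor_walk_start by (simp only: step2 fst_conv)
qed

lemma strict_mono_start: "strict_mono start"
  by (rule strict_mono_Suc_iff[THEN iffD2]) (simp add: start_Suc)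

text \<open>The intervals from \<open>start j\<close> to \<open>start (Suc j)\<close> cover all
  times. Offset 0 is the source and offset 1 is vertex 2 or 3, so only offset 2 can be a hit, and it
  occurs just for \<open>j\<close> in \<open>hits X Y S\<close>.\<close>

lemma hitting_times_compressor:
  "hitting_times 1 {4, 5} (compressor_rotor X Y r) = (\<lambda>j. start j + 2) ` hits X Y S"
proof (intro subset_antisym subsetI)
  fix t
  assume "t \<in> hitting_times 1 {4, 5} (compressor_rotor X Y r)"
  then have t: "rotor_walk 1 {4, 5} (compressor_rotor X Y r) t \<in> {4, 5}"
    by (simp add: hitting_times_def)
  have "\<exists>j. start j \<le> t \<and> t < start (Suc j)"
  proof (induction t)
    case 0
    show ?case
      by (rule exI[of _ 0]) (simp add: start_def)
  next
    case (Suc t)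
    then obtain j where "start j \<le> t" "t < start (Suc j)"
      by blast
    moreover have "start (Suc j) < start (Suc (Suc j))"
      using start_Suc[of "Suc j"] by simp
    ultimately show ?case
      by (metis Suc_leI le_SucI order_le_less)
  qed
  then obtain j where "start j \<le> t" "t < start (Suc j)"
    by blast
  then obtain d where d: "t = start j + d" "d < (if j \<in> hits X Y S then 3 else 2)"
    by (metis start_Suc le_Suc_ex nat_add_left_cancel_less)
  have 1: "(stp ^^ 1) x = stp x" for x
    by (simp add: One_nat_def del: rotor_step.simps)
  have "d \<noteq> 0"
    using t rotor_walk_start[of j 0] d(1) by (intro notI) simp
  moreover have "d \<noteq> 1"
    using t rotor_walk_start[of j 1] d(1)
    by (intro notI) (simp del: rotor_step.simps add: 1 step1 split: if_splits)
  ultimately have "j \<in> hits X Y S" "d = 2"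
    using d(2) by (auto split: if_splits)
  with d(1) show "t \<in> (\<lambda>j. start j + 2) ` hits X Y S"
    by simp
next
  fix t
  assume "t \<in> (\<lambda>j. start j + 2) ` hits X Y S"
  then obtain j where "j \<in> hits X Y S" "t = start j + 2"
    by blast
  then show "t \<in> hitting_times 1 {4, 5} (compressor_rotor X Y r)"
    using rotor_walk_start_2[of j] by (simp add: hitting_times_def split: if_splits)
qed

lemma infinite_hitting_times_compressor:
  "infinite (hits X Y S) \<Longrightarrow> infinite (hitting_times 1 {4, 5} (compressor_rotor X Y r))"
  unfolding hitting_times_compressor
  by (simp add: finite_image_iff inj_on_def strict_mono_eq[OF strict_mono_start])

lemma compressor_eq:
  assumes "infinite (hits X Y S)"
  shows "compressor X Y r k = (if enumerate (hits X Y S) k \<in> S then 1 else 2)"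
proof -
  have "strict_mono (\<lambda>j. start j + 2)"
    using strict_mono_start by (simp add: strict_mono_def)
  then show ?thesis
    using assms enumerate_in_set[OF assms, of k] rotor_walk_start_2[of "enumerate (hits X Y S) k"]
    by (simp add: compressor_def hitting_sequence_def hitting_times_compressor
        enumerate_image_strict_mono del: add_2_eq_Suc')
qed

end

section \<open>Balance and period of the output\<close>

lemma cnt_hits:
  assumes "balanced_set n S"
  shows "cnt (thin S (exit_set X S)) (2 * (k * (2 * n))) = k * n"
    and "cnt (hits X Y S) (2 * (k * (2 * n))) = k * (2 * n)"
proof -
  \<comment> \<open>After \<open>2 * k\<close> input blocks the number of visits to vertex 2 or 3 is
    itself a block boundary, so the balance of the exit set applies there.\<close>
  have half: "cnt R (2 * (k * (2 * n))) = k * (2 * n)" if "balanced_set n R" for R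
    using that[unfolded balanced_set_def, rule_format, of "2 * k"] by (simp add: algebra_simps)
  have thin: "cnt (thin R (exit_set Z S)) (2 * (k * (2 * n))) = k * n" if "balanced_set n R" for R Z
    using balanced_set_exit_set[OF assms, of Z]
    unfolding cnt_thin half[OF that] balanced_set_def by blast
  show "cnt (thin S (exit_set X S)) (2 * (k * (2 * n))) = k * n"
    by (rule thin[OF assms])
  have "thin S (exit_set X S) \<inter> thin (- S) (exit_set Y S) = {}"
    by (auto simp: thin_def)
  from cnt_Un[OF this] show "cnt (hits X Y S) (2 * (k * (2 * n))) = k * (2 * n)"
    unfolding hits_def using thin[OF assms] thin[OF balanced_set_Compl[OF assms]] by simp
qed

text \<open>By balance, \<open>2 * p\<close> source departures advance the rotors at vertices 2 and
  3 by exactly \<open>p\<close> each, which is again a period.\<close>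

lemma hits_shift:
  assumes S: "balanced_set n S" and p: "p = k * (2 * n)" and per: "\<And>i. i + p \<in> S \<longleftrightarrow> i \<in> S"
  shows "j + 2 * p \<in> hits X Y S \<longleftrightarrow> j \<in> hits X Y S"
proof -
  have half: "cnt R (2 * p) = p" if "balanced_set n R" for R
    using that[unfolded balanced_set_def, rule_format, of "2 * k"] by (simp add: p algebra_simps)
  have per2: "i + 2 * p \<in> S \<longleftrightarrow> i \<in> S" for i
    using per[of i] per[of "i + p"] by (simp add: mult_2 add.assoc)
  have exit: "i + p \<in> exit_set Z S \<longleftrightarrow> i \<in> exit_set Z S" for Z i
    using per by (cases Z) (simp_all add: exit_set_def)
  show ?thesis
    unfolding hits_def Un_iff
    by (intro arg_cong2[of _ _ _ _ "(\<or>)"] thin_shift)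
      (simp_all add: per2 exit half S balanced_set_Compl)
qed

lemma balanced_wrt_compressor:
  assumes "balanced_wrt (2 * n) p r"
  shows "infinite (hitting_times 1 {4, 5} (compressor_rotor X Y r))"
    and "balanced_wrt (2 * n) p (compressor X Y r)"
proof -
  define S where "S = {i. r i = 1}"
  let ?H = "hits X Y S"
  note r = balanced_wrtD[OF assms, folded S_def]
  obtain q where q: "p = q * (2 * n)"
    using r(3) by (metis dvd_def mult.commute)
  have n: "n > 0"
    using r(2) q by (auto simp: is_period_def intro: Nat.gr0I)
  have per: "i + p \<in> S \<longleftrightarrow> i \<in> S" for i
    using r(2) by (simp add: S_def is_period_def)
  have inf: "infinite ?H"
  proof (rule infinite_if_cnt_unbounded)
    fix m
    \<comment> \<open>The witness for \<open>l\<close> is \<open>2 * (Suc m * (2 * n))\<close>,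
      below which there are \<open>Suc m * (2 * n)\<close> hits.\<close>
    have "m < Suc m * (2 * n)"
      using n by (cases n) auto
    then show "\<exists>l. m < cnt ?H l"
      using cnt_hits(2)[OF r(4)] by metis
  qed
  then show "infinite (hitting_times 1 {4, 5} (compressor_rotor X Y r))"
    by (rule infinite_hitting_times_compressor[rotated]) (simp add: S_def)
  have c: "compressor X Y r k = (if enumerate ?H k \<in> S then 1 else 2)" for k
    by (rule compressor_eq[OF _ inf]) (simp add: S_def)
  show "balanced_wrt (2 * n) p (compressor X Y r)"
  proof (rule balanced_wrtI)
    have "enumerate ?H (k + p) = enumerate ?H k + 2 * p" for k
      using enumerate_shift[OF inf hits_shift[OF r(4) q per], of k] cnt_hits(2)[OF r(4), of X Y q] q
      by simp
    moreover have "i + 2 * p \<in> S \<longleftrightarrow> i \<in> S" for i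
      using per[of i] per[of "i + p"] by (simp add: mult_2 add.assoc)
    ultimately show "is_period (compressor X Y r) p"
      using r(2) by (simp add: is_period_def c)
    \<comment> \<open>A hit after a source departure to vertex 2 is a hit of target 4, that is, an
      output 1.\<close>
    have "?H \<inter> S = thin S (exit_set X S)"
      by (auto simp: hits_def thin_def)
    \<comment> \<open>The first \<open>k * (2 * n)\<close> outputs come from the first
      \<open>2 * (k * (2 * n))\<close> source departures, of which \<open>k * n\<close> lead to
      target 4.\<close>
    then have "cnt {k. enumerate ?H k \<in> S} (k * (2 * n)) = k * n" for k
      using cnt_vimage_enumerate[OF inf, of S "2 * (k * (2 * n))"] cnt_hits(1)[OF r(4), of X k] cnt_hits(2)[OF r(4), of X Y k]
      by simp
    then show "balanced_set n {k. compressor X Y r k = 1}"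
      by (simp add: balanced_set_def c)
  qed (use r(3) in \<open>auto simp: c\<close>)
qed

theorem theorem7p2:
  fixes n :: nat and X Y :: variant
  shows "(\<forall>p r. balanced_wrt (2 * n) p r \<longrightarrow>
            infinite (hitting_times 1 {4, 5} (compressor_rotor X Y r)) \<and>
            balanced_wrt (2 * n) p (compressor X Y r)) \<and>
         (\<forall>r \<in> balanced_rotor_types (2 * n).
            normalize_states (compressor X Y r) \<in> balanced_rotor_types (2 * n))"
  \<comment> \<open>The same \<open>p\<close> witnesses balance before the compressor, after it and
    after the renaming.\<close>
  using balanced_wrt_compressor balanced_wrt_normalize_states normalize_states_0
  unfolding balanced_rotor_types_def by blast

end
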